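(* Let $\mathcal C$ be an essentially small category, $T$ the class of sieves on objects of $\mathcal C$, $S$ the class of embeddings $Q\hookrightarrow P$ of presheaves on $\mathcal C$, and $$F_R:(\mathcal P(T),\subseteq)\to(\mathcal P(S),\supseteq),\qquad G_R:(\mathcal P(S),\supseteq)\to(\mathcal P(T),\subseteq)$$ the adjoint pair defined by the duality relation $R\subseteq T\times S$ between sieves and sub-presheaves (see context). Then: (i) For every collection $J$ of sieves on $\mathcal C$, the image $\overline J=G_R\circ F_R(J)$ is the topology of $\mathcal C$ generated by $J$, and the subclass $F_R(J)=F_R(\overline J)$ consists of the sub-presheaves $Q\hookrightarrow P$ which are closed for the topology $\overline J$, defining the operation of $\overline J$-closure of sub-presheaves $(Q\hookrightarrow P)\mapsto(\overline Q\hookrightarrow P)$. (ii) For every collection $I$ of embeddings of presheaves on $\mathcal C$, the image $\overline I=F_R\circ G_R(I)$ is the smallest closure property containing the elements of $I$, and the corresponding topology $G_R(I)=G_R(\overline I)$ consists of the sieves $C\hookrightarrow y(X)$ whose closure (for the closure property $\overline I$) is the maximal sieve $y(X)$.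
   Context: $\widehat{\mathcal C}=[\mathcal C^{\rm op},{\rm Set}]$, $y$ is the Yoneda embedding; a sieve on $X$ is a sub-presheaf $C\hookrightarrow y(X)$; for $x:X'\to X$, $x^*C=C\times_{y(X)}y(X')$. An embedding $Q\hookrightarrow P$ is the inclusion of a sub-presheaf. $\mathcal P(\cdot)$ denotes the collection of subclasses. The relation $R\subseteq T\times S$ consists of the pairs $(C\hookrightarrow y(X),\,Q\hookrightarrow P)$ such that, for every $x:X'\to X$ in $\mathcal C$ and every $p\in P(X')$, one has $p\in Q(X')$ as soon as every $(x':X''\to X')\in x^*C$ sends $p$ into $Q(X'')\subseteq P(X'')$. One sets $$F_R(J)=\{s\in S\mid(t,s)\in R\ \forall t\in J\},\qquad G_R(I)=\{t\in T\mid(t,s)\in R\ \forall s\in I\}.$$ A sub-presheaf $Q\hookrightarrow P$ is closed for a topology $J$ if a section $p\in P(X)$ belongs to $Q(X)$ whenever there is a $J$-covering family $(x_k:X_k\to X)_k$ sending $p$ into all the $Q(X_k)$; the $J$-closure of $Q\hookrightarrow P$ is the smallest closed sub-presheaf of $P$ containing $Q$. The topology generated by a collection of sieves is the smallest Grothendieck topology containing it. A closure property is a subclass $I'\subseteq S$ such that: (1) it contains all equalities $Q=P$; (2) it is stable under base change along all morphisms $P'\to P$; (3) it is stable under arbitrary intersections of sub-presheaves of a same presheaf; (4) denoting by $\overline Q\hookrightarrow P$ the smallest element of $I'$ containing $Q\hookrightarrow P$ (called its closure), one has $\overline{P'\times_PQ}=P'\times_P\overline Q$ for every $P'\to P$.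 *)

theory Defs
  imports Main
begin

text \<open>
  The objects of Set are the subsets of a fixed type 'u selected by a predicate small.
  Only closure under subsets and images is required, so Set may be all of Pow UNIV, or
  the sets of cardinality below an inaccessible one (a Grothendieck universe), etc.
\<close>

definition set_universe :: "('u set \<Rightarrow> bool) \<Rightarrow> bool" where
  "set_universe small \<longleftrightarrow>
     (\<forall>A B. small A \<and> B \<subseteq> A \<longrightarrow> small B) \<and>
     (\<forall>A (f :: 'u \<Rightarrow> 'u). small A \<longrightarrow> small (f ` A))"

text \<open>
  Objects live in an arbitrary type 'o, which may be large compared with 'u.
  Hom-sets are not assumed disjoint, so operations on arrows carry their objects:
  if f is in Hom C X Y and g in Hom C Y Z, their composite is Comp C X Y Z g f.
\<close>

record ('o, 'u) cat =
  Ob :: "'o set"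
  Hom :: "'o \<Rightarrow> 'o \<Rightarrow> 'u set"
  Idt :: "'o \<Rightarrow> 'u"
  Comp :: "'o \<Rightarrow> 'o \<Rightarrow> 'o \<Rightarrow> 'u \<Rightarrow> 'u \<Rightarrow> 'u"

definition locally_small_category :: "('u set \<Rightarrow> bool) \<Rightarrow> ('o, 'u) cat \<Rightarrow> bool" where
  "locally_small_category small C \<longleftrightarrow>
     (\<forall>X\<in>Ob C. \<forall>Y\<in>Ob C. small (Hom C X Y)) \<and>
     (\<forall>X\<in>Ob C. Idt C X \<in> Hom C X X) \<and>
     (\<forall>X\<in>Ob C. \<forall>Y\<in>Ob C. \<forall>Z\<in>Ob C. \<forall>f\<in>Hom C X Y. \<forall>g\<in>Hom C Y Z.
        Comp C X Y Z g f \<in> Hom C X Z) \<and>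
     (\<forall>X\<in>Ob C. \<forall>Y\<in>Ob C. \<forall>f\<in>Hom C X Y.
        Comp C X X Y f (Idt C X) = f \<and> Comp C X Y Y (Idt C Y) f = f) \<and>
     (\<forall>W\<in>Ob C. \<forall>X\<in>Ob C. \<forall>Y\<in>Ob C. \<forall>Z\<in>Ob C.
        \<forall>f\<in>Hom C W X. \<forall>g\<in>Hom C X Y. \<forall>h\<in>Hom C Y Z.
        Comp C W X Z (Comp C X Y Z h g) f = Comp C W Y Z h (Comp C W X Y g f))"

definition small_category :: "('u set \<Rightarrow> bool) \<Rightarrow> ('u, 'u) cat \<Rightarrow> bool" where
  "small_category small D \<longleftrightarrow> locally_small_category small D \<and> small (Ob D)"

definition isomorphic_objects :: "('o, 'u) cat \<Rightarrow> 'o \<Rightarrow> 'o \<Rightarrow> bool" where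
  "isomorphic_objects C X Y \<longleftrightarrow>
     (\<exists>f\<in>Hom C X Y. \<exists>g\<in>Hom C Y X.
        Comp C X Y X g f = Idt C X \<and> Comp C Y X Y f g = Idt C Y)"

definition is_functor ::
  "('p, 'u) cat \<Rightarrow> ('o, 'u) cat \<Rightarrow> ('p \<Rightarrow> 'o) \<Rightarrow> ('p \<Rightarrow> 'p \<Rightarrow> 'u \<Rightarrow> 'u) \<Rightarrow> bool" where
  "is_functor D C \<phi> \<psi> \<longleftrightarrow>
     (\<forall>X\<in>Ob D. \<phi> X \<in> Ob C) \<and>
     (\<forall>X\<in>Ob D. \<forall>Y\<in>Ob D. \<forall>f\<in>Hom D X Y. \<psi> X Y f \<in> Hom C (\<phi> X) (\<phi> Y)) \<and>
     (\<forall>X\<in>Ob D. \<psi> X X (Idt D X) = Idt C (\<phi> X)) \<and>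
     (\<forall>X\<in>Ob D. \<forall>Y\<in>Ob D. \<forall>Z\<in>Ob D. \<forall>f\<in>Hom D X Y. \<forall>g\<in>Hom D Y Z.
        \<psi> X Z (Comp D X Y Z g f) = Comp C (\<phi> X) (\<phi> Y) (\<phi> Z) (\<psi> Y Z g) (\<psi> X Y f))"

definition is_equivalence ::
  "('p, 'u) cat \<Rightarrow> ('o, 'u) cat \<Rightarrow> ('p \<Rightarrow> 'o) \<Rightarrow> ('p \<Rightarrow> 'p \<Rightarrow> 'u \<Rightarrow> 'u) \<Rightarrow> bool" where
  "is_equivalence D C \<phi> \<psi> \<longleftrightarrow>
     is_functor D C \<phi> \<psi> \<and>
     (\<forall>X\<in>Ob D. \<forall>Y\<in>Ob D. bij_betw (\<psi> X Y) (Hom D X Y) (Hom C (\<phi> X) (\<phi> Y))) \<and>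
     (\<forall>Z\<in>Ob C. \<exists>X\<in>Ob D. isomorphic_objects C (\<phi> X) Z)"

definition essentially_small :: "('u set \<Rightarrow> bool) \<Rightarrow> ('o, 'u) cat \<Rightarrow> bool" where
  "essentially_small small C \<longleftrightarrow>
     locally_small_category small C \<and>
     (\<exists>(D :: ('u, 'u) cat) \<phi> \<psi>. small_category small D \<and> is_equivalence D C \<phi> \<psi>)"

text \<open>
  For f in Hom C Y X, the restriction map from Sec P X to Sec P Y is Res P X Y f.
  Values outside the meaningful range are fixed, so that equality of records
  (and of families of subsets) is equality of presheaves (and of sub-presheaves).
\<close>

record ('o, 'u) psh =
  Sec :: "'o \<Rightarrow> 'u set"
  Res :: "'o \<Rightarrow> 'o \<Rightarrow> 'u \<Rightarrow> 'u \<Rightarrow> 'u"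

definition presheaf :: "('u set \<Rightarrow> bool) \<Rightarrow> ('o, 'u) cat \<Rightarrow> ('o, 'u) psh \<Rightarrow> bool" where
  "presheaf small C P \<longleftrightarrow>
     (\<forall>X\<in>Ob C. small (Sec P X)) \<and>
     (\<forall>X\<in>Ob C. \<forall>Y\<in>Ob C. \<forall>f\<in>Hom C Y X. \<forall>p\<in>Sec P X. Res P X Y f p \<in> Sec P Y) \<and>
     (\<forall>X\<in>Ob C. \<forall>p\<in>Sec P X. Res P X X (Idt C X) p = p) \<and>
     (\<forall>X\<in>Ob C. \<forall>Y\<in>Ob C. \<forall>Z\<in>Ob C. \<forall>f\<in>Hom C Y X. \<forall>g\<in>Hom C Z Y. \<forall>p\<in>Sec P X.
        Res P X Z (Comp C Z Y X f g) p = Res P Y Z g (Res P X Y f p)) \<and>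
     (\<forall>X. X \<notin> Ob C \<longrightarrow> Sec P X = {}) \<and>
     (\<forall>X Y f p. \<not> (X \<in> Ob C \<and> Y \<in> Ob C \<and> f \<in> Hom C Y X \<and> p \<in> Sec P X)
        \<longrightarrow> Res P X Y f p = undefined)"

definition presheaf_morphism ::
  "('o, 'u) cat \<Rightarrow> ('o, 'u) psh \<Rightarrow> ('o, 'u) psh \<Rightarrow> ('o \<Rightarrow> 'u \<Rightarrow> 'u) \<Rightarrow> bool" where
  "presheaf_morphism C P' P \<alpha> \<longleftrightarrow>
     (\<forall>X\<in>Ob C. \<forall>p\<in>Sec P' X. \<alpha> X p \<in> Sec P X) \<and>
     (\<forall>X\<in>Ob C. \<forall>Y\<in>Ob C. \<forall>f\<in>Hom C Y X. \<forall>p\<in>Sec P' X.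
        \<alpha> Y (Res P' X Y f p) = Res P X Y f (\<alpha> X p))"

text \<open>
  A sub-presheaf of P is given by its sets of sections, its restriction maps being those
  of P. An embedding of Q into P is the pair (Q, P); it is an equality iff Q = Sec P.
\<close>

definition subpresheaf :: "('o, 'u) cat \<Rightarrow> ('o \<Rightarrow> 'u set) \<Rightarrow> ('o, 'u) psh \<Rightarrow> bool" where
  "subpresheaf C Q P \<longleftrightarrow>
     (\<forall>X. Q X \<subseteq> Sec P X) \<and>
     (\<forall>X\<in>Ob C. \<forall>Y\<in>Ob C. \<forall>f\<in>Hom C Y X. \<forall>q\<in>Q X. Res P X Y f q \<in> Q Y)"

definition embeddings ::
  "('u set \<Rightarrow> bool) \<Rightarrow> ('o, 'u) cat \<Rightarrow> (('o \<Rightarrow> 'u set) \<times> ('o, 'u) psh) set" where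
  "embeddings small C = {(Q, P). presheaf small C P \<and> subpresheaf C Q P}"

text \<open>
  The fibre product of P' and Q over P, as a sub-presheaf of P'; here \<alpha> is a morphism
  from P' to P.
\<close>

definition base_change ::
  "('o \<Rightarrow> 'u \<Rightarrow> 'u) \<Rightarrow> ('o, 'u) psh \<Rightarrow> ('o \<Rightarrow> 'u set) \<Rightarrow> 'o \<Rightarrow> 'u set" where
  "base_change \<alpha> P' Q = (\<lambda>X. {p \<in> Sec P' X. \<alpha> X p \<in> Q X})"

text \<open>The intersection of the empty family of sub-presheaves of P is P.\<close>

definition intersection ::
  "('o, 'u) psh \<Rightarrow> ('o \<Rightarrow> 'u set) set \<Rightarrow> 'o \<Rightarrow> 'u set" where
  "intersection P \<Q> = (\<lambda>X. {p \<in> Sec P X. \<forall>Q\<in>\<Q>. p \<in> Q X})"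

definition yoneda :: "('o, 'u) cat \<Rightarrow> 'o \<Rightarrow> ('o, 'u) psh" where
  "yoneda C X =
     \<lparr> Sec = (\<lambda>Y. if Y \<in> Ob C then Hom C Y X else {}),
       Res = (\<lambda>Y Z f h. if Y \<in> Ob C \<and> Z \<in> Ob C \<and> f \<in> Hom C Z Y \<and> h \<in> Hom C Y X
                        then Comp C Z Y X h f else undefined) \<rparr>"

definition yoneda_map :: "('o, 'u) cat \<Rightarrow> 'o \<Rightarrow> 'o \<Rightarrow> 'u \<Rightarrow> 'o \<Rightarrow> 'u \<Rightarrow> 'u" where
  "yoneda_map C X' X x = (\<lambda>Y h. Comp C Y X' X x h)"

lemma presheaf_yoneda:
  assumes "locally_small_category small C" and "X \<in> Ob C"
  shows "presheaf small C (yoneda C X)"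
  using assms unfolding locally_small_category_def presheaf_def yoneda_def by simp

lemma presheaf_morphism_yoneda_map:
  assumes "locally_small_category small C" and "X \<in> Ob C" and "X' \<in> Ob C" and "x \<in> Hom C X' X"
  shows "presheaf_morphism C (yoneda C X') (yoneda C X) (yoneda_map C X' X x)"
  using assms
  unfolding locally_small_category_def presheaf_morphism_def yoneda_def yoneda_map_def by simp

text \<open>A sieve D on X is the pair (D, X), as the object X need not be determined by D.\<close>

definition sieves :: "('o, 'u) cat \<Rightarrow> (('o \<Rightarrow> 'u set) \<times> 'o) set" where
  "sieves C = {(D, X). X \<in> Ob C \<and> subpresheaf C D (yoneda C X)}"

definition sieve_pullback ::
  "('o, 'u) cat \<Rightarrow> 'o \<Rightarrow> 'o \<Rightarrow> 'u \<Rightarrow> ('o \<Rightarrow> 'u set) \<Rightarrow> 'o \<Rightarrow> 'u set" where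
  "sieve_pullback C X' X x D = base_change (yoneda_map C X' X x) (yoneda C X') D"

definition duality ::
  "('u set \<Rightarrow> bool) \<Rightarrow> ('o, 'u) cat \<Rightarrow>
     ((('o \<Rightarrow> 'u set) \<times> 'o) \<times> (('o \<Rightarrow> 'u set) \<times> ('o, 'u) psh)) set" where
  "duality small C =
     {((D, X), (Q, P)). (D, X) \<in> sieves C \<and> (Q, P) \<in> embeddings small C \<and>
        (\<forall>X'\<in>Ob C. \<forall>x\<in>Hom C X' X. \<forall>p\<in>Sec P X'.
           (\<forall>X''\<in>Ob C. \<forall>x'\<in>sieve_pullback C X' X x D X''. Res P X' X'' x' p \<in> Q X'')
             \<longrightarrow> p \<in> Q X')}"

definition F_R ::
  "('u set \<Rightarrow> bool) \<Rightarrow> ('o, 'u) cat \<Rightarrow> (('o \<Rightarrow> 'u set) \<times> 'o) set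
     \<Rightarrow> (('o \<Rightarrow> 'u set) \<times> ('o, 'u) psh) set" where
  "F_R small C J = {s \<in> embeddings small C. \<forall>t\<in>J. (t, s) \<in> duality small C}"

definition G_R ::
  "('u set \<Rightarrow> bool) \<Rightarrow> ('o, 'u) cat \<Rightarrow> (('o \<Rightarrow> 'u set) \<times> ('o, 'u) psh) set
     \<Rightarrow> (('o \<Rightarrow> 'u set) \<times> 'o) set" where
  "G_R small C I = {t \<in> sieves C. \<forall>s\<in>I. (t, s) \<in> duality small C}"

lemma F_R_G_R_adjoint:
  assumes "J \<subseteq> sieves C" and "I \<subseteq> embeddings small C"
  shows "I \<subseteq> F_R small C J \<longleftrightarrow> J \<subseteq> G_R small C I"
  using assms unfolding F_R_def G_R_def by blast

definition topology :: "('o, 'u) cat \<Rightarrow> (('o \<Rightarrow> 'u set) \<times> 'o) set \<Rightarrow> bool" where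
  "topology C J \<longleftrightarrow>
     J \<subseteq> sieves C \<and>
     (\<forall>X\<in>Ob C. (Sec (yoneda C X), X) \<in> J) \<and>
     (\<forall>(D, X)\<in>J. \<forall>X'\<in>Ob C. \<forall>x\<in>Hom C X' X. (sieve_pullback C X' X x D, X') \<in> J) \<and>
     (\<forall>(D, X)\<in>J. \<forall>E. (E, X) \<in> sieves C \<and>
        (\<forall>Y\<in>Ob C. \<forall>f\<in>D Y. (sieve_pullback C Y X f E, Y) \<in> J) \<longrightarrow> (E, X) \<in> J)"

definition is_generated_topology ::
  "('o, 'u) cat \<Rightarrow> (('o \<Rightarrow> 'u set) \<times> 'o) set \<Rightarrow> (('o \<Rightarrow> 'u set) \<times> 'o) set \<Rightarrow> bool" where
  "is_generated_topology C J K \<longleftrightarrow>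
     topology C K \<and> J \<subseteq> K \<and> (\<forall>K'. topology C K' \<and> J \<subseteq> K' \<longrightarrow> K \<subseteq> K')"

text \<open>
  A family of arrows to X is a set of pairs (Y, f) with f in Hom C Y X; it is covering
  if the sieve it generates belongs to the topology.
\<close>

definition generated_sieve :: "('o, 'u) cat \<Rightarrow> 'o \<Rightarrow> ('o \<times> 'u) set \<Rightarrow> 'o \<Rightarrow> 'u set" where
  "generated_sieve C X \<F> =
     (\<lambda>Z. {h. Z \<in> Ob C \<and> (\<exists>(Y, f)\<in>\<F>. \<exists>g\<in>Hom C Z Y. h = Comp C Z Y X f g)})"

definition covering_family ::
  "('o, 'u) cat \<Rightarrow> (('o \<Rightarrow> 'u set) \<times> 'o) set \<Rightarrow> 'o \<Rightarrow> ('o \<times> 'u) set \<Rightarrow> bool" where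
  "covering_family C J X \<F> \<longleftrightarrow>
     (\<forall>(Y, f)\<in>\<F>. Y \<in> Ob C \<and> f \<in> Hom C Y X) \<and> (generated_sieve C X \<F>, X) \<in> J"

definition closed_embeddings ::
  "('u set \<Rightarrow> bool) \<Rightarrow> ('o, 'u) cat \<Rightarrow> (('o \<Rightarrow> 'u set) \<times> 'o) set
     \<Rightarrow> (('o \<Rightarrow> 'u set) \<times> ('o, 'u) psh) set" where
  "closed_embeddings small C J =
     {(Q, P) \<in> embeddings small C.
        \<forall>X\<in>Ob C. \<forall>p\<in>Sec P X.
          (\<exists>\<F>. covering_family C J X \<F> \<and> (\<forall>(Y, f)\<in>\<F>. Res P X Y f p \<in> Q Y)) \<longrightarrow> p \<in> Q X}"

definition is_closure ::
  "(('o \<Rightarrow> 'u set) \<times> ('o, 'u) psh) set \<Rightarrow> ('o, 'u) psh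
     \<Rightarrow> ('o \<Rightarrow> 'u set) \<Rightarrow> ('o \<Rightarrow> 'u set) \<Rightarrow> bool" where
  "is_closure I P Q Q' \<longleftrightarrow>
     (Q', P) \<in> I \<and> (\<forall>X. Q X \<subseteq> Q' X) \<and>
     (\<forall>Q''. (Q'', P) \<in> I \<and> (\<forall>X. Q X \<subseteq> Q'' X) \<longrightarrow> (\<forall>X. Q' X \<subseteq> Q'' X))"

definition closure_of ::
  "(('o \<Rightarrow> 'u set) \<times> ('o, 'u) psh) set \<Rightarrow> ('o, 'u) psh
     \<Rightarrow> ('o \<Rightarrow> 'u set) \<Rightarrow> 'o \<Rightarrow> 'u set" where
  "closure_of I P Q = (THE Q'. is_closure I P Q Q')"

text \<open>In the last clause the closures exist by the first and third ones.\<close>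

definition closure_property ::
  "('u set \<Rightarrow> bool) \<Rightarrow> ('o, 'u) cat \<Rightarrow> (('o \<Rightarrow> 'u set) \<times> ('o, 'u) psh) set \<Rightarrow> bool" where
  "closure_property small C I \<longleftrightarrow>
     I \<subseteq> embeddings small C \<and>
     (\<forall>P. presheaf small C P \<longrightarrow> (Sec P, P) \<in> I) \<and>
     (\<forall>(Q, P)\<in>I. \<forall>P' \<alpha>. presheaf small C P' \<and> presheaf_morphism C P' P \<alpha>
        \<longrightarrow> (base_change \<alpha> P' Q, P') \<in> I) \<and>
     (\<forall>P \<Q>. presheaf small C P \<and> (\<forall>Q\<in>\<Q>. (Q, P) \<in> I) \<longrightarrow> (intersection P \<Q>, P) \<in> I) \<and>
     (\<forall>(Q, P)\<in>embeddings small C. \<forall>P' \<alpha>. presheaf small C P' \<and> presheaf_morphism C P' P \<alpha>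
        \<longrightarrow> closure_of I P' (base_change \<alpha> P' Q) = base_change \<alpha> P' (closure_of I P Q))"

lemma closure_of_is_closure:
  assumes "closure_property small C I" and "(Q, P) \<in> embeddings small C"
  shows "is_closure I P Q (closure_of I P Q)"
proof -
  let ?Q = "intersection P {Q'. (Q', P) \<in> I \<and> (\<forall>X. Q X \<subseteq> Q' X)}"
  have P: "presheaf small C P" and sub: "\<And>X. Q X \<subseteq> Sec P X"
    using assms(2) by (simp_all add: embeddings_def subpresheaf_def)
  have inter: "(intersection P \<Q>, P) \<in> I" if "\<forall>Q\<in>\<Q>. (Q, P) \<in> I" for \<Q>
    using assms(1) P that by (simp add: closure_property_def)
  have "(?Q, P) \<in> I"
    by (rule inter) simp
  moreover have "Q X \<subseteq> ?Q X" for X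
    using sub[of X] by (auto simp: intersection_def)
  moreover have "?Q X \<subseteq> Q'' X" if "(Q'', P) \<in> I" "\<forall>X. Q X \<subseteq> Q'' X" for Q'' X
    using that by (auto simp: intersection_def)
  ultimately have c: "is_closure I P Q ?Q"
    by (simp add: is_closure_def)
  moreover have "Q' = ?Q" if "is_closure I P Q Q'" for Q'
  proof (rule ext)
    fix X
    show "Q' X = ?Q X"
      using that c unfolding is_closure_def by (meson subset_antisym)
  qed
  ultimately show ?thesis
    unfolding closure_of_def by (rule theI)
qed

definition is_generated_closure_property ::
  "('u set \<Rightarrow> bool) \<Rightarrow> ('o, 'u) cat \<Rightarrow> (('o \<Rightarrow> 'u set) \<times> ('o, 'u) psh) set
     \<Rightarrow> (('o \<Rightarrow> 'u set) \<times> ('o, 'u) psh) set \<Rightarrow> bool" where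
  "is_generated_closure_property small C I K \<longleftrightarrow>
     closure_property small C K \<and> I \<subseteq> K \<and>
     (\<forall>I'. closure_property small C I' \<and> I \<subseteq> I' \<longrightarrow> K \<subseteq> I')"

end

theory Submission
  imports Defs
begin

text \<open>
  Everything is controlled by one construction. A section \<open>p\<close> of \<open>P\<close> over \<open>X\<close> is a morphism
  from \<open>y(X)\<close> to \<open>P\<close>, and pulling \<open>Q\<close> back along it gives the sieve of those arrows which send
  \<open>p\<close> into \<open>Q\<close>; call it the sieve of \<open>p\<close>. A sieve \<open>D\<close> on \<open>X\<close> is dual to \<open>Q\<close> in \<open>P\<close> iff, for each
  \<open>x : X' \<rightarrow> X\<close>, no section over \<open>X'\<close> outside \<open>Q\<close> has a sieve containing \<open>x\<^sup>*D\<close>. Pullbacks of sieves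
  are themselves sieves of sections (\<open>sieve_pullback_eq\<close>), and restricting a section or moving it
  along a morphism of presheaves does to its sieve what one expects (\<open>sieve_pullback_section_sieve\<close>,
  \<open>section_sieve_base_change\<close>).

  Sieves to sub-presheaves. Any \<open>G_R I\<close> is a topology (\<open>topology_G_R\<close>). If \<open>K\<close> is a topology, the
  sections of \<open>P\<close> whose sieve lies in \<open>K\<close> form the smallest element of \<open>F_R K\<close> containing \<open>Q\<close>
  (\<open>is_closure_local_closure\<close>). For a sieve \<open>D\<close> in \<open>G_R (F_R K)\<close>, the closure of \<open>D\<close> in
  \<open>y(X)\<close> is dual to \<open>D\<close>, hence contains the identity, which says that \<open>D\<close> is in \<open>K\<close>
  (\<open>G_R_F_R_topology\<close>). So the fixed points of the monotone operator
  \<open>G_R \<circ> F_R\<close> are exactly the topologies, and its value at \<open>J\<close> is the least topology above \<open>J\<close>.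

  Sub-presheaves to sieves. Any \<open>F_R K\<close> with \<open>K\<close> a topology is a closure property, the explicit
  formula for the closure being visibly stable under base change (\<open>closure_property_F_R\<close>).
  Conversely let \<open>I\<close> be a closure property. By stability of closures under base change, a sieve
  belongs to \<open>G_R I\<close> iff its closure is maximal (\<open>G_R_closure_property\<close>). If \<open>Q\<close> in \<open>P\<close>
  belongs to \<open>F_R (G_R I)\<close> and \<open>p\<close> is a section of the closure of \<open>Q\<close>, then the sieve of \<open>p\<close> has
  maximal closure, so lies in \<open>G_R I\<close>, and duality forces \<open>p\<close> into \<open>Q\<close>. So the
  closure properties are exactly the fixed points of \<open>F_R \<circ> G_R\<close>
  (\<open>F_R_G_R_closure_property\<close>), and its value at \<open>I\<close> is the least one above \<open>I\<close>.
\<close>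

section \<open>Categories, presheaves and sieves of sections\<close>

locale locally_small =
  fixes small :: "'u set \<Rightarrow> bool" and C :: "('o, 'u) cat"
  assumes locally_small: "locally_small_category small C"
begin

lemma Idt_in: "X \<in> Ob C \<Longrightarrow> Idt C X \<in> Hom C X X"
  using locally_small by (simp add: locally_small_category_def)

lemma Comp_in:
  "X \<in> Ob C \<Longrightarrow> Y \<in> Ob C \<Longrightarrow> Z \<in> Ob C \<Longrightarrow> f \<in> Hom C X Y \<Longrightarrow> g \<in> Hom C Y Z
    \<Longrightarrow> Comp C X Y Z g f \<in> Hom C X Z"
  using locally_small by (simp add: locally_small_category_def)

lemma Comp_Idt:
  "X \<in> Ob C \<Longrightarrow> Y \<in> Ob C \<Longrightarrow> f \<in> Hom C X Y \<Longrightarrow> Comp C X X Y f (Idt C X) = f"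
  "X \<in> Ob C \<Longrightarrow> Y \<in> Ob C \<Longrightarrow> f \<in> Hom C X Y \<Longrightarrow> Comp C X Y Y (Idt C Y) f = f"
  using locally_small by (simp_all add: locally_small_category_def)

lemma Res_in:
  "presheaf small C P \<Longrightarrow> X \<in> Ob C \<Longrightarrow> Y \<in> Ob C \<Longrightarrow> f \<in> Hom C Y X \<Longrightarrow> p \<in> Sec P X
    \<Longrightarrow> Res P X Y f p \<in> Sec P Y"
  unfolding presheaf_def by blast

lemma Res_Idt: "presheaf small C P \<Longrightarrow> X \<in> Ob C \<Longrightarrow> p \<in> Sec P X \<Longrightarrow> Res P X X (Idt C X) p = p"
  unfolding presheaf_def by blast

lemma Res_Comp:
  "presheaf small C P \<Longrightarrow> X \<in> Ob C \<Longrightarrow> Y \<in> Ob C \<Longrightarrow> Z \<in> Ob C \<Longrightarrow> f \<in> Hom C Y X \<Longrightarrow> g \<in> Hom C Z Y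
    \<Longrightarrow> p \<in> Sec P X \<Longrightarrow> Res P X Z (Comp C Z Y X f g) p = Res P Y Z g (Res P X Y f p)"
  unfolding presheaf_def by blast

lemma Sec_Ob: "presheaf small C P \<Longrightarrow> p \<in> Sec P X \<Longrightarrow> X \<in> Ob C"
  unfolding presheaf_def by blast

lemma presheaf_y: "X \<in> Ob C \<Longrightarrow> presheaf small C (yoneda C X)"
  using locally_small by (rule presheaf_yoneda)

lemma in_Sec_yoneda: "h \<in> Sec (yoneda C X) Y \<longleftrightarrow> Y \<in> Ob C \<and> h \<in> Hom C Y X"
  by (simp add: yoneda_def)

lemma Res_yoneda:
  "Y \<in> Ob C \<Longrightarrow> Z \<in> Ob C \<Longrightarrow> f \<in> Hom C Z Y \<Longrightarrow> h \<in> Hom C Y X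
    \<Longrightarrow> Res (yoneda C X) Y Z f h = Comp C Z Y X h f"
  by (simp add: yoneda_def)

lemma sieve_Ob: "(D, X) \<in> sieves C \<Longrightarrow> X \<in> Ob C"
  by (simp add: sieves_def)

lemma sieve_subpresheaf: "(D, X) \<in> sieves C \<Longrightarrow> subpresheaf C D (yoneda C X)"
  by (simp add: sieves_def)

lemma sieve_in: "(D, X) \<in> sieves C \<Longrightarrow> f \<in> D Y \<Longrightarrow> Y \<in> Ob C \<and> f \<in> Hom C Y X"
  unfolding sieves_def subpresheaf_def using in_Sec_yoneda by blast

lemma sieve_Comp:
  assumes "(D, X) \<in> sieves C" "f \<in> D Y" "Z \<in> Ob C" "g \<in> Hom C Z Y"
  shows "Comp C Z Y X f g \<in> D Z"
proof -
  have f: "Y \<in> Ob C" "f \<in> Hom C Y X"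
    using sieve_in assms by auto
  have "Res (yoneda C X) Y Z g f \<in> D Z"
    using assms f unfolding sieves_def subpresheaf_def by blast
  then show ?thesis
    using Res_yoneda assms f by simp
qed

lemma maximal_sieve: "X \<in> Ob C \<Longrightarrow> (Sec (yoneda C X), X) \<in> sieves C"
  using Res_in[OF presheaf_y] by (auto simp: sieves_def subpresheaf_def in_Sec_yoneda)

lemma sieve_eq_maximal:
  assumes "(D, X) \<in> sieves C" "Idt C X \<in> D X"
  shows "D = Sec (yoneda C X)"
proof (intro ext set_eqI iffI)
  fix Y f
  assume "f \<in> Sec (yoneda C X) Y"
  then have f: "Y \<in> Ob C" "f \<in> Hom C Y X"
    by (simp_all add: in_Sec_yoneda)
  then have "Comp C Y X X (Idt C X) f \<in> D Y"
    using sieve_Comp assms by blast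
  then show "f \<in> D Y"
    using f Comp_Idt sieve_Ob assms(1) by simp
next
  fix Y f
  assume "f \<in> D Y"
  then show "f \<in> Sec (yoneda C X) Y"
    using sieve_in assms(1) by (simp add: in_Sec_yoneda)
qed

lemma base_change_subpresheaf:
  assumes "presheaf small C P'" "presheaf_morphism C P' P \<alpha>" "subpresheaf C Q P"
  shows "subpresheaf C (base_change \<alpha> P' Q) P'"
  unfolding subpresheaf_def
proof (intro conjI allI ballI)
  show "base_change \<alpha> P' Q X \<subseteq> Sec P' X" for X
    by (auto simp: base_change_def)
  fix X Y f q
  assume X: "X \<in> Ob C" "Y \<in> Ob C" "f \<in> Hom C Y X" and q: "q \<in> base_change \<alpha> P' Q X"
  then have "\<alpha> Y (Res P' X Y f q) = Res P X Y f (\<alpha> X q)"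
    using assms(2) by (simp add: presheaf_morphism_def base_change_def)
  moreover have "Res P X Y f (\<alpha> X q) \<in> Q Y"
    using assms(3) X q by (simp add: subpresheaf_def base_change_def)
  ultimately show "Res P' X Y f q \<in> base_change \<alpha> P' Q Y"
    using Res_in assms(1) X q by (simp add: base_change_def)
qed

lemma base_change_Sec:
  assumes "presheaf small C P'" "presheaf_morphism C P' P \<alpha>"
  shows "base_change \<alpha> P' (Sec P) = Sec P'"
proof
  fix X
  show "base_change \<alpha> P' (Sec P) X = Sec P' X"
    using assms(2) Sec_Ob[OF assms(1)] unfolding base_change_def presheaf_morphism_def by blast
qed

text \<open>
  By the Yoneda lemma a section \<open>p\<close> over \<open>X\<close> is the morphism from \<open>y(X)\<close> sending \<open>f\<close> to the
  restriction of \<open>p\<close> along \<open>f\<close>. Writing its sieve as a base change makes the stability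
  conditions of closure properties apply to it directly.
\<close>

definition section_sieve :: "('o, 'u) psh \<Rightarrow> ('o \<Rightarrow> 'u set) \<Rightarrow> 'o \<Rightarrow> 'u \<Rightarrow> 'o \<Rightarrow> 'u set" where
  "section_sieve P Q X p = base_change (\<lambda>Y f. Res P X Y f p) (yoneda C X) Q"

lemma in_section_sieve:
  "f \<in> section_sieve P Q X p Y \<longleftrightarrow> Y \<in> Ob C \<and> f \<in> Hom C Y X \<and> Res P X Y f p \<in> Q Y"
  by (simp add: section_sieve_def base_change_def in_Sec_yoneda)

lemma section_morphism:
  assumes "presheaf small C P" "p \<in> Sec P X"
  shows "presheaf_morphism C (yoneda C X) P (\<lambda>Y f. Res P X Y f p)"
  using assms Sec_Ob[OF assms] Res_in Res_Comp Res_yoneda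
  by (auto simp: presheaf_morphism_def in_Sec_yoneda)

lemma section_sieve_in_sieves:
  assumes "presheaf small C P" "subpresheaf C Q P" "p \<in> Sec P X"
  shows "(section_sieve P Q X p, X) \<in> sieves C"
  unfolding sieves_def section_sieve_def
  using base_change_subpresheaf[OF presheaf_y section_morphism] Sec_Ob assms by blast

lemma Idt_in_section_sieve:
  assumes "presheaf small C P" "p \<in> Sec P X"
  shows "Idt C X \<in> section_sieve P Q X p X \<longleftrightarrow> p \<in> Q X"
  using assms Sec_Ob Idt_in Res_Idt by (simp add: in_section_sieve)

lemma sieve_pullback_eq:
  "X' \<in> Ob C \<Longrightarrow> x \<in> Hom C X' X
    \<Longrightarrow> sieve_pullback C X' X x D = section_sieve (yoneda C X) D X' x"
  by (auto simp: sieve_pullback_def section_sieve_def base_change_def yoneda_map_def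
      in_Sec_yoneda Res_yoneda)

lemma sieve_pullback_in_sieves:
  "(D, X) \<in> sieves C \<Longrightarrow> X' \<in> Ob C \<Longrightarrow> x \<in> Hom C X' X \<Longrightarrow> (sieve_pullback C X' X x D, X') \<in> sieves C"
  by (simp add: sieve_pullback_eq section_sieve_in_sieves presheaf_y sieve_Ob sieve_subpresheaf
      in_Sec_yoneda)

lemma sieve_pullback_section_sieve:
  assumes "presheaf small C P" "p \<in> Sec P X" "X' \<in> Ob C" "x \<in> Hom C X' X"
  shows "sieve_pullback C X' X x (section_sieve P Q X p) = section_sieve P Q X' (Res P X X' x p)"
  using assms Sec_Ob[OF assms(1,2)] Res_Comp Comp_in
  by (auto simp: sieve_pullback_eq Res_yoneda in_section_sieve fun_eq_iff)

lemma sieve_pullback_Comp: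
  assumes "X \<in> Ob C" "X' \<in> Ob C" "x \<in> Hom C X' X" "Y \<in> Ob C" "f \<in> Hom C Y X'"
  shows "sieve_pullback C Y X' f (sieve_pullback C X' X x D)
    = sieve_pullback C Y X (Comp C Y X' X x f) D"
  using assms Comp_in sieve_pullback_section_sieve[OF presheaf_y]
  by (simp add: sieve_pullback_eq[of X' x] sieve_pullback_eq[of Y "Comp C Y X' X x f"]
      in_Sec_yoneda Res_yoneda)

lemma sieve_pullback_Idt:
  assumes "(D, X) \<in> sieves C"
  shows "sieve_pullback C X X (Idt C X) D = D"
proof (intro ext set_eqI)
  fix Y f
  have X: "X \<in> Ob C"
    using assms by (rule sieve_Ob)
  have "f \<in> sieve_pullback C X X (Idt C X) D Y \<longleftrightarrow> Y \<in> Ob C \<and> f \<in> Hom C Y X \<and> f \<in> D Y"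
    using X Idt_in Comp_Idt(2) by (auto simp: sieve_pullback_eq in_section_sieve Res_yoneda)
  then show "f \<in> sieve_pullback C X X (Idt C X) D Y \<longleftrightarrow> f \<in> D Y"
    using sieve_in[OF assms] by blast
qed

lemma sieve_pullback_eq_maximal:
  assumes "(D, X) \<in> sieves C" "f \<in> D Y"
  shows "sieve_pullback C Y X f D = Sec (yoneda C Y)"
proof (rule sieve_eq_maximal)
  have f: "Y \<in> Ob C" "f \<in> Hom C Y X"
    using sieve_in assms by auto
  then show "(sieve_pullback C Y X f D, Y) \<in> sieves C"
    using sieve_pullback_in_sieves assms by blast
  show "Idt C Y \<in> sieve_pullback C Y X f D Y"
    using f assms Idt_in_section_sieve[OF presheaf_y] sieve_Ob
    by (simp add: sieve_pullback_eq in_Sec_yoneda)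
qed

lemma section_sieve_base_change:
  assumes "presheaf small C P'" "presheaf_morphism C P' P \<alpha>" "p \<in> Sec P' X"
  shows "section_sieve P' (base_change \<alpha> P' Q) X p = section_sieve P Q X (\<alpha> X p)"
  using assms Sec_Ob[OF assms(1,3)] Res_in[OF assms(1)]
  by (auto simp: in_section_sieve base_change_def presheaf_morphism_def fun_eq_iff)

section \<open>The duality relation\<close>

lemma duality_iff:
  assumes "(D, X) \<in> sieves C" "(Q, P) \<in> embeddings small C"
  shows "((D, X), (Q, P)) \<in> duality small C \<longleftrightarrow>
    (\<forall>X'\<in>Ob C. \<forall>x\<in>Hom C X' X. \<forall>p\<in>Sec P X'.
      sieve_pullback C X' X x D \<le> section_sieve P Q X' p \<longrightarrow> p \<in> Q X')"
proof -
  have "sieve_pullback C X' X x D \<le> section_sieve P Q X' p \<longleftrightarrow>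
    (\<forall>X''\<in>Ob C. \<forall>x'\<in>sieve_pullback C X' X x D X''. Res P X' X'' x' p \<in> Q X'')"
    if "X' \<in> Ob C" "x \<in> Hom C X' X" for X' x p
    using sieve_in[OF sieve_pullback_in_sieves[OF assms(1) that]]
    unfolding le_fun_def subset_iff in_section_sieve by blast
  with assms show ?thesis
    by (simp add: duality_def)
qed

text \<open>
  The instance \<open>x = id\<close> of the duality relation. It suffices whenever \<open>D\<close> varies in a class of
  sieves stable under pullback.
\<close>

lemma dualityD:
  assumes "((D, X), (Q, P)) \<in> duality small C" "p \<in> Sec P X" "D \<le> section_sieve P Q X p"
  shows "p \<in> Q X"
proof -
  have D: "(D, X) \<in> sieves C" and Q: "(Q, P) \<in> embeddings small C"
    using assms(1) by (auto simp: duality_def)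
  have "X \<in> Ob C"
    using D by (rule sieve_Ob)
  moreover have "sieve_pullback C X X (Idt C X) D \<le> section_sieve P Q X p"
    using assms(3) sieve_pullback_Idt[OF D] by simp
  ultimately show ?thesis
    using assms(1,2) Idt_in duality_iff[OF D Q] by blast
qed

lemma F_R_embedding:
  "(Q, P) \<in> F_R small C J \<Longrightarrow> presheaf small C P \<and> subpresheaf C Q P"
  by (simp add: F_R_def embeddings_def)

lemma F_R_D: "(Q, P) \<in> F_R small C J \<Longrightarrow> (D, X) \<in> J \<Longrightarrow> ((D, X), (Q, P)) \<in> duality small C"
  by (auto simp: F_R_def)

lemma G_R_D: "(D, X) \<in> G_R small C I \<Longrightarrow> (Q, P) \<in> I \<Longrightarrow> ((D, X), (Q, P)) \<in> duality small C"
  by (auto simp: G_R_def)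

lemma F_R_I:
  assumes "J \<subseteq> sieves C" "presheaf small C P" "subpresheaf C Q P"
    and "\<And>D X X' x p. (D, X) \<in> J \<Longrightarrow> X' \<in> Ob C \<Longrightarrow> x \<in> Hom C X' X \<Longrightarrow> p \<in> Sec P X'
      \<Longrightarrow> sieve_pullback C X' X x D \<le> section_sieve P Q X' p \<Longrightarrow> p \<in> Q X'"
  shows "(Q, P) \<in> F_R small C J"
proof -
  have Q: "(Q, P) \<in> embeddings small C"
    using assms by (simp add: embeddings_def)
  moreover have "(t, (Q, P)) \<in> duality small C" if "t \<in> J" for t
  proof (cases t)
    case (Pair D X)
    with that assms(1) have D: "(D, X) \<in> sieves C" "(D, X) \<in> J"
      by auto
    then show ?thesis
      unfolding Pair duality_iff[OF D(1) Q] using assms(4) by blast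
  qed
  ultimately show ?thesis
    by (simp add: F_R_def)
qed

lemma G_R_I:
  assumes "I \<subseteq> embeddings small C" "(D, X) \<in> sieves C"
    and "\<And>Q P X' x p. (Q, P) \<in> I \<Longrightarrow> presheaf small C P \<Longrightarrow> subpresheaf C Q P
      \<Longrightarrow> X' \<in> Ob C \<Longrightarrow> x \<in> Hom C X' X \<Longrightarrow> p \<in> Sec P X'
      \<Longrightarrow> sieve_pullback C X' X x D \<le> section_sieve P Q X' p \<Longrightarrow> p \<in> Q X'"
  shows "(D, X) \<in> G_R small C I"
proof -
  have "((D, X), s) \<in> duality small C" if "s \<in> I" for s
  proof (cases s)
    case (Pair Q P)
    with that assms(1) have Q: "(Q, P) \<in> embeddings small C" "(Q, P) \<in> I"
      by auto
    then have "presheaf small C P" "subpresheaf C Q P"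
      by (simp_all add: embeddings_def)
    with Q show ?thesis
      unfolding Pair duality_iff[OF assms(2) Q(1)] using assms(3) by blast
  qed
  with assms(2) show ?thesis
    by (simp add: G_R_def)
qed

text \<open>
  The first three closure-property axioms hold for every image of \<open>F_R\<close>; base change replaces
  the sieve of a section by the sieve of its image.
\<close>

lemma F_R_maximal: "J \<subseteq> sieves C \<Longrightarrow> presheaf small C P \<Longrightarrow> (Sec P, P) \<in> F_R small C J"
  by (rule F_R_I) (auto simp: subpresheaf_def Res_in)

lemma F_R_base_change:
  assumes J: "J \<subseteq> sieves C" and Q: "(Q, P) \<in> F_R small C J"
    and P': "presheaf small C P'" "presheaf_morphism C P' P \<alpha>"
  shows "(base_change \<alpha> P' Q, P') \<in> F_R small C J"
proof (rule F_R_I[OF J P'(1)])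
  show "subpresheaf C (base_change \<alpha> P' Q) P'"
    using base_change_subpresheaf P' F_R_embedding[OF Q] by blast
  fix D X X' x p
  assume D: "(D, X) \<in> J" and X': "X' \<in> Ob C" "x \<in> Hom C X' X" and p: "p \<in> Sec P' X'"
    and le: "sieve_pullback C X' X x D \<le> section_sieve P' (base_change \<alpha> P' Q) X' p"
  have \<alpha>: "\<alpha> X' p \<in> Sec P X'"
    using P' X' p by (simp add: presheaf_morphism_def)
  have "(D, X) \<in> sieves C" "(Q, P) \<in> embeddings small C"
    using D J Q by (auto simp: F_R_def)
  then have "\<alpha> X' p \<in> Q X'"
    using F_R_D[OF Q D] duality_iff X' \<alpha> le section_sieve_base_change[OF P' p] by auto
  with p show "p \<in> base_change \<alpha> P' Q X'"
    by (simp add: base_change_def)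
qed

lemma F_R_intersection:
  assumes J: "J \<subseteq> sieves C" and P: "presheaf small C P"
    and Qs: "\<And>Q. Q \<in> \<Q> \<Longrightarrow> (Q, P) \<in> F_R small C J"
  shows "(intersection P \<Q>, P) \<in> F_R small C J"
proof (rule F_R_I[OF J P])
  show "subpresheaf C (intersection P \<Q>) P"
    using Res_in[OF P] F_R_embedding[OF Qs]
    by (auto simp: subpresheaf_def intersection_def)
  fix D X X' x p
  assume D: "(D, X) \<in> J" and X': "X' \<in> Ob C" "x \<in> Hom C X' X" and p: "p \<in> Sec P X'"
    and le: "sieve_pullback C X' X x D \<le> section_sieve P (intersection P \<Q>) X' p"
  have "p \<in> Q X'" if "Q \<in> \<Q>" for Q
  proof -
    have "section_sieve P (intersection P \<Q>) X' p \<le> section_sieve P Q X' p"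
      using that by (auto simp: le_fun_def in_section_sieve intersection_def)
    with le have "sieve_pullback C X' X x D \<le> section_sieve P Q X' p"
      by (rule order_trans)
    moreover have "(D, X) \<in> sieves C" "(Q, P) \<in> embeddings small C"
      using D J Qs[OF that] by (auto simp: F_R_def)
    ultimately show ?thesis
      using F_R_D[OF Qs[OF that] D] duality_iff X' p by blast
  qed
  with p show "p \<in> intersection P \<Q> X'"
    by (simp add: intersection_def)
qed

text \<open>
  Only the transitivity axiom needs an argument. If \<open>E\<close> is locally covering on \<open>D\<close> and \<open>x\<^sup>*E\<close>
  sends \<open>p\<close> into \<open>Q\<close>, then for \<open>f\<close> in \<open>x\<^sup>*D\<close> the sieve \<open>(x f)\<^sup>*E\<close> sends the restriction of \<open>p\<close>
  along \<open>f\<close> into \<open>Q\<close>; hence this restriction lies in \<open>Q\<close>, and duality for \<open>D\<close> concludes.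
\<close>

lemma topology_G_R:
  assumes I: "I \<subseteq> embeddings small C"
  shows "topology C (G_R small C I)"
  unfolding topology_def
proof (intro conjI ballI)
  have sieve: "(D, X) \<in> sieves C" if "(D, X) \<in> G_R small C I" for D X
    using that by (simp add: G_R_def)
  show "G_R small C I \<subseteq> sieves C"
    by (auto simp: G_R_def)
  show "(Sec (yoneda C X), X) \<in> G_R small C I" if X: "X \<in> Ob C" for X
  proof (rule G_R_I[OF I maximal_sieve[OF X]])
    fix Q P X' x p
    assume P: "presheaf small C P" "p \<in> Sec P X'"
      and X': "X' \<in> Ob C" "x \<in> Hom C X' X"
      and le: "sieve_pullback C X' X x (Sec (yoneda C X)) \<le> section_sieve P Q X' p"
    have "sieve_pullback C X' X x (Sec (yoneda C X)) = Sec (yoneda C X')"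
      using X X' by (simp add: sieve_pullback_eq_maximal maximal_sieve in_Sec_yoneda)
    then have "Sec (yoneda C X') X' \<subseteq> section_sieve P Q X' p X'"
      using le by (simp add: le_fun_def)
    then have "Idt C X' \<in> section_sieve P Q X' p X'"
      using X' Idt_in by (auto simp: in_Sec_yoneda)
    with P show "p \<in> Q X'"
      using Idt_in_section_sieve by blast
  qed
  show "case t of (D, X) \<Rightarrow> \<forall>X'\<in>Ob C. \<forall>x\<in>Hom C X' X. (sieve_pullback C X' X x D, X') \<in> G_R small C I"
    if t: "t \<in> G_R small C I" for t
  proof (cases t)
    case (Pair D X)
    have D: "(D, X) \<in> G_R small C I" "(D, X) \<in> sieves C"
      using t sieve Pair by auto
    have "(sieve_pullback C X' X x D, X') \<in> G_R small C I"
      if X': "X' \<in> Ob C" "x \<in> Hom C X' X" for X' x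
    proof (rule G_R_I[OF I sieve_pullback_in_sieves[OF D(2) X']])
      fix Q P Y f p
      assume Q: "(Q, P) \<in> I" and Y: "Y \<in> Ob C" "f \<in> Hom C Y X'" "p \<in> Sec P Y"
        and le: "sieve_pullback C Y X' f (sieve_pullback C X' X x D) \<le> section_sieve P Q Y p"
      have "Comp C Y X' X x f \<in> Hom C Y X"
        using Comp_in sieve_Ob D X' Y by blast
      moreover have "sieve_pullback C Y X (Comp C Y X' X x f) D \<le> section_sieve P Q Y p"
        using le sieve_pullback_Comp sieve_Ob D X' Y by simp
      moreover have "(Q, P) \<in> embeddings small C"
        using Q I by blast
      ultimately show "p \<in> Q Y"
        using duality_iff[OF D(2)] G_R_D[OF D(1) Q] Y by blast
    qed
    then show ?thesis
      by (simp add: Pair)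
  qed
  show "case t of (D, X) \<Rightarrow> \<forall>E. (E, X) \<in> sieves C
      \<and> (\<forall>Y\<in>Ob C. \<forall>f\<in>D Y. (sieve_pullback C Y X f E, Y) \<in> G_R small C I) \<longrightarrow> (E, X) \<in> G_R small C I"
    if t: "t \<in> G_R small C I" for t
  proof (cases t)
    case (Pair D X)
    have D: "(D, X) \<in> G_R small C I" "(D, X) \<in> sieves C"
      using t sieve Pair by auto
    note X = sieve_Ob[OF D(2)]
    have "(E, X) \<in> G_R small C I"
      if E: "(E, X) \<in> sieves C" "\<forall>Y\<in>Ob C. \<forall>f\<in>D Y. (sieve_pullback C Y X f E, Y) \<in> G_R small C I" for E
    proof (rule G_R_I[OF I E(1)])
      fix Q P X' x p
      assume Q: "(Q, P) \<in> I" and P: "presheaf small C P"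
        and X': "X' \<in> Ob C" "x \<in> Hom C X' X" and p: "p \<in> Sec P X'"
        and le: "sieve_pullback C X' X x E \<le> section_sieve P Q X' p"
      have "Res P X' Y f p \<in> Q Y" if f: "Y \<in> Ob C" "f \<in> Hom C Y X'" "Comp C Y X' X x f \<in> D Y" for Y f
      proof (rule dualityD)
        let ?E = "sieve_pullback C Y X (Comp C Y X' X x f) E"
        show "((?E, Y), (Q, P)) \<in> duality small C"
          using E(2) f G_R_D Q by blast
        show "Res P X' Y f p \<in> Sec P Y"
          using Res_in P X' f p by blast
        have "?E = sieve_pullback C Y X' f (sieve_pullback C X' X x E)"
          using sieve_pullback_Comp X X' f by simp
        also have "\<dots> \<le> sieve_pullback C Y X' f (section_sieve P Q X' p)"
          using le unfolding sieve_pullback_def base_change_def le_fun_def by blast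
        also have "\<dots> = section_sieve P Q Y (Res P X' Y f p)"
          using sieve_pullback_section_sieve P p f by blast
        finally show "?E \<le> section_sieve P Q Y (Res P X' Y f p)" .
      qed
      then have "sieve_pullback C X' X x D \<le> section_sieve P Q X' p"
        using X' by (auto simp: le_fun_def sieve_pullback_eq in_section_sieve Res_yoneda)
      moreover have "(Q, P) \<in> embeddings small C"
        using Q I by blast
      ultimately show "p \<in> Q X'"
        using duality_iff[OF D(2)] G_R_D[OF D(1) Q] X' p by blast
    qed
    then show ?thesis
      by (simp add: Pair)
  qed
qed

section \<open>Closure for a topology\<close>

lemma topology_sieves: "topology C K \<Longrightarrow> K \<subseteq> sieves C"
  by (simp add: topology_def)

lemma topology_maximal: "topology C K \<Longrightarrow> X \<in> Ob C \<Longrightarrow> (Sec (yoneda C X), X) \<in> K"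
  by (simp add: topology_def)

lemma topology_pullback:
  "topology C K \<Longrightarrow> (D, X) \<in> K \<Longrightarrow> X' \<in> Ob C \<Longrightarrow> x \<in> Hom C X' X \<Longrightarrow> (sieve_pullback C X' X x D, X') \<in> K"
  by (auto simp: topology_def)

lemma topology_local:
  assumes "topology C K" "(D, X) \<in> K" "(E, X) \<in> sieves C"
    and "\<And>Y f. Y \<in> Ob C \<Longrightarrow> f \<in> D Y \<Longrightarrow> (sieve_pullback C Y X f E, Y) \<in> K"
  shows "(E, X) \<in> K"
proof -
  have "\<forall>E. (E, X) \<in> sieves C \<and> (\<forall>Y\<in>Ob C. \<forall>f\<in>D Y. (sieve_pullback C Y X f E, Y) \<in> K) \<longrightarrow> (E, X) \<in> K"
    using assms(1,2) unfolding topology_def by blast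
  with assms(3,4) show ?thesis
    by blast
qed

definition local_closure ::
  "(('o \<Rightarrow> 'u set) \<times> 'o) set \<Rightarrow> ('o, 'u) psh \<Rightarrow> ('o \<Rightarrow> 'u set) \<Rightarrow> 'o \<Rightarrow> 'u set" where
  "local_closure K P Q = (\<lambda>X. {p \<in> Sec P X. (section_sieve P Q X p, X) \<in> K})"

lemma local_closure_subpresheaf:
  assumes K: "topology C K" and P: "presheaf small C P"
  shows "subpresheaf C (local_closure K P Q) P"
  using Res_in[OF P] topology_pullback[OF K] sieve_pullback_section_sieve[OF P, symmetric]
  by (auto simp: subpresheaf_def local_closure_def)

text \<open>
  The local closure is closed by the transitivity axiom: a sieve in \<open>K\<close> sending \<open>p\<close> into the
  local closure makes the sieve of \<open>p\<close> locally covering. It is minimal because the sieve of \<open>p\<close>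
  itself is a member of \<open>K\<close> to which duality can be applied.
\<close>

lemma is_closure_local_closure:
  assumes K: "topology C K" and P: "presheaf small C P" and Q: "subpresheaf C Q P"
  shows "is_closure (F_R small C K) P Q (local_closure K P Q)"
  unfolding is_closure_def
proof (intro conjI allI impI)
  show "(local_closure K P Q, P) \<in> F_R small C K"
  proof (rule F_R_I[OF topology_sieves[OF K] P local_closure_subpresheaf[OF K P]])
    fix D X X' x p
    assume D: "(D, X) \<in> K" and X': "X' \<in> Ob C" "x \<in> Hom C X' X" and p: "p \<in> Sec P X'"
      and le: "sieve_pullback C X' X x D \<le> section_sieve P (local_closure K P Q) X' p"
    have "(section_sieve P Q X' p, X') \<in> K"
    proof (rule topology_local[OF K topology_pullback[OF K D X'] section_sieve_in_sieves[OF P Q p]])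
      fix Y f
      assume "Y \<in> Ob C" and "f \<in> sieve_pullback C X' X x D Y"
      with le have "f \<in> section_sieve P (local_closure K P Q) X' p Y"
        by (auto simp: le_fun_def)
      then show "(sieve_pullback C Y X' f (section_sieve P Q X' p), Y) \<in> K"
        using sieve_pullback_section_sieve[OF P p] by (auto simp: in_section_sieve local_closure_def)
    qed
    with p show "p \<in> local_closure K P Q X'"
      by (simp add: local_closure_def)
  qed
  show "Q X \<subseteq> local_closure K P Q X" for X
  proof
    fix q
    assume q: "q \<in> Q X"
    then have "q \<in> Sec P X"
      using Q by (auto simp: subpresheaf_def)
    moreover from this have "section_sieve P Q X q = Sec (yoneda C X)"
      using sieve_eq_maximal section_sieve_in_sieves Idt_in_section_sieve P Q q by blast
    ultimately show "q \<in> local_closure K P Q X"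
      using topology_maximal[OF K] Sec_Ob[OF P] by (simp add: local_closure_def)
  qed
  fix Q' X
  assume Q': "(Q', P) \<in> F_R small C K \<and> (\<forall>X. Q X \<subseteq> Q' X)"
  show "local_closure K P Q X \<subseteq> Q' X"
  proof
    fix p
    assume "p \<in> local_closure K P Q X"
    then have p: "p \<in> Sec P X" "(section_sieve P Q X p, X) \<in> K"
      by (simp_all add: local_closure_def)
    have "section_sieve P Q X p \<le> section_sieve P Q' X p"
      using Q' unfolding le_fun_def subset_iff in_section_sieve by blast
    with p Q' show "p \<in> Q' X"
      using dualityD F_R_D by blast
  qed
qed

lemma is_closure_unique: "is_closure I P Q A \<Longrightarrow> is_closure I P Q B \<Longrightarrow> A = B"
  unfolding is_closure_def by (intro ext subset_antisym) blast+

lemma closure_of_F_R: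
  assumes "topology C K" "presheaf small C P" "subpresheaf C Q P"
  shows "closure_of (F_R small C K) P Q = local_closure K P Q"
  unfolding closure_of_def
  using is_closure_local_closure[OF assms] is_closure_unique by (intro the_equality) auto

lemma local_closure_base_change:
  assumes "presheaf small C P'" "presheaf_morphism C P' P \<alpha>"
  shows "local_closure K P' (base_change \<alpha> P' Q) = base_change \<alpha> P' (local_closure K P Q)"
proof (intro ext set_eqI)
  fix X p
  have "\<alpha> X p \<in> Sec P X" if "p \<in> Sec P' X"
    using that assms(2) Sec_Ob[OF assms(1)] by (simp add: presheaf_morphism_def)
  moreover have "p \<in> base_change \<alpha> P' (local_closure K P Q) X
      \<longleftrightarrow> p \<in> Sec P' X \<and> \<alpha> X p \<in> local_closure K P Q X"
    by (simp add: base_change_def)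
  ultimately show "p \<in> local_closure K P' (base_change \<alpha> P' Q) X
    \<longleftrightarrow> p \<in> base_change \<alpha> P' (local_closure K P Q) X"
    using section_sieve_base_change[OF assms] by (auto simp: local_closure_def)
qed

lemma closure_property_F_R:
  assumes K: "topology C K"
  shows "closure_property small C (F_R small C K)"
proof -
  note J = topology_sieves[OF K]
  have "closure_of (F_R small C K) P' (base_change \<alpha> P' Q)
      = base_change \<alpha> P' (closure_of (F_R small C K) P Q)"
    if "presheaf small C P" "subpresheaf C Q P" "presheaf small C P'" "presheaf_morphism C P' P \<alpha>"
    for P Q P' \<alpha>
    using that K by (simp add: closure_of_F_R base_change_subpresheaf local_closure_base_change)
  then show ?thesis
    unfolding closure_property_def
    using F_R_maximal[OF J] F_R_base_change[OF J] F_R_intersection[OF J]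
    by (auto simp: embeddings_def dest: F_R_embedding)
qed

text \<open>
  A covering family and the sieve it generates send \<open>p\<close> into \<open>Q\<close> simultaneously. Conversely a
  sieve is generated by the family of all its arrows.
\<close>

lemma closed_embeddings_eq:
  assumes K: "topology C K"
  shows "closed_embeddings small C K = F_R small C K"
proof (intro equalityI subrelI)
  fix Q P
  assume QP: "(Q, P) \<in> F_R small C K"
  then have P: "presheaf small C P" and Q: "subpresheaf C Q P"
    using F_R_embedding by auto
  have "p \<in> Q X"
    if X: "X \<in> Ob C" "p \<in> Sec P X" and F: "covering_family C K X \<F>" "\<forall>(Y, f)\<in>\<F>. Res P X Y f p \<in> Q Y"
    for X p \<F>
  proof (rule dualityD)
    show "((generated_sieve C X \<F>, X), (Q, P)) \<in> duality small C"
      using F QP F_R_D by (auto simp: covering_family_def)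
    show "p \<in> Sec P X"
      by fact
    have "Comp C Z Y X f g \<in> section_sieve P Q X p Z"
      if "Z \<in> Ob C" "(Y, f) \<in> \<F>" "g \<in> Hom C Z Y" for Z Y f g
    proof -
      have f: "Y \<in> Ob C" "f \<in> Hom C Y X" "Res P X Y f p \<in> Q Y"
        using F that by (auto simp: covering_family_def)
      then have "Res P Y Z g (Res P X Y f p) \<in> Q Z"
        using Q that by (simp add: subpresheaf_def)
      with f X that P show ?thesis
        using Res_Comp Comp_in by (simp add: in_section_sieve)
    qed
    then show "generated_sieve C X \<F> \<le> section_sieve P Q X p"
      by (auto simp: generated_sieve_def le_fun_def)
  qed
  with P Q show "(Q, P) \<in> closed_embeddings small C K"
    unfolding closed_embeddings_def embeddings_def by blast
next
  fix Q P
  assume QP: "(Q, P) \<in> closed_embeddings small C K"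
  then have P: "presheaf small C P" and Q: "subpresheaf C Q P"
    by (simp_all add: closed_embeddings_def embeddings_def)
  have closed: "p \<in> Q X" if "X \<in> Ob C" "p \<in> Sec P X" "covering_family C K X \<F>"
    "\<forall>(Y, f)\<in>\<F>. Res P X Y f p \<in> Q Y" for X p \<F>
    using QP that unfolding closed_embeddings_def by blast
  show "(Q, P) \<in> F_R small C K"
  proof (rule F_R_I[OF topology_sieves[OF K] P Q])
    fix D X X' x p
    assume D: "(D, X) \<in> K" and X': "X' \<in> Ob C" "x \<in> Hom C X' X" and p: "p \<in> Sec P X'"
      and le: "sieve_pullback C X' X x D \<le> section_sieve P Q X' p"
    define E where "E = sieve_pullback C X' X x D"
    have E: "(E, X') \<in> K"
      unfolding E_def using topology_pullback K D X' by blast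
    then have sieve: "(E, X') \<in> sieves C"
      using topology_sieves[OF K] by blast
    define \<F> where "\<F> = {(Y, f). f \<in> E Y}"
    have "generated_sieve C X' \<F> = E"
    proof (intro ext set_eqI iffI)
      fix Z h
      assume "h \<in> generated_sieve C X' \<F> Z"
      then show "h \<in> E Z"
        using sieve_Comp[OF sieve] by (auto simp: generated_sieve_def \<F>_def)
    next
      fix Z h
      assume h: "h \<in> E Z"
      then have "Z \<in> Ob C" "h \<in> Hom C Z X'"
        using sieve_in[OF sieve] by auto
      then have "h = Comp C Z Z X' h (Idt C Z)" "Idt C Z \<in> Hom C Z Z" "Z \<in> Ob C" "(Z, h) \<in> \<F>"
        using Comp_Idt Idt_in X' h by (simp_all add: \<F>_def)
      then show "h \<in> generated_sieve C X' \<F> Z"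
        unfolding generated_sieve_def by blast
    qed
    then have "covering_family C K X' \<F>"
      using E sieve_in[OF sieve] by (auto simp: covering_family_def \<F>_def)
    moreover have "\<forall>(Y, f)\<in>\<F>. Res P X' Y f p \<in> Q Y"
      using le unfolding \<F>_def E_def[symmetric] le_fun_def subset_iff in_section_sieve by blast
    ultimately show "p \<in> Q X'"
      using closed X' p by blast
  qed
qed

section \<open>Fixed points of the Galois connection\<close>

text \<open>
  The closure of \<open>D\<close> in \<open>y(X)\<close> is dual to \<open>D\<close> and contains \<open>D\<close>, hence contains the identity;
  and the sieve of the identity, as a section of \<open>y(X)\<close>, is \<open>D\<close>.
\<close>

lemma G_R_F_R_topology:
  assumes K: "topology C K"
  shows "G_R small C (F_R small C K) = K"
proof (intro equalityI subrelI)
  fix D X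
  assume D: "(D, X) \<in> G_R small C (F_R small C K)"
  then have sieve: "(D, X) \<in> sieves C"
    by (simp add: G_R_def)
  then have X: "X \<in> Ob C"
    by (rule sieve_Ob)
  let ?cl = "local_closure K (yoneda C X) D"
  have id_sieve: "section_sieve (yoneda C X) D X (Idt C X) = D"
    using sieve_pullback_Idt[OF sieve] sieve_pullback_eq X Idt_in by simp
  have cl: "is_closure (F_R small C K) (yoneda C X) D ?cl"
    using is_closure_local_closure[OF K presheaf_y[OF X]] sieve_subpresheaf[OF sieve] .
  have "Idt C X \<in> ?cl X"
  proof (rule dualityD[where Q = ?cl])
    show "((D, X), ?cl, yoneda C X) \<in> duality small C"
      using cl D G_R_D unfolding is_closure_def by blast
    show "Idt C X \<in> Sec (yoneda C X) X"
      using X Idt_in by (simp add: in_Sec_yoneda)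
    have "section_sieve (yoneda C X) D X (Idt C X) \<le> section_sieve (yoneda C X) ?cl X (Idt C X)"
      using cl unfolding is_closure_def le_fun_def subset_iff in_section_sieve by blast
    then show "D \<le> section_sieve (yoneda C X) ?cl X (Idt C X)"
      by (simp add: id_sieve)
  qed
  then show "(D, X) \<in> K"
    by (simp add: local_closure_def id_sieve)
next
  fix D X
  assume "(D, X) \<in> K"
  then show "(D, X) \<in> G_R small C (F_R small C K)"
    using topology_sieves[OF K] by (auto simp: G_R_def F_R_def)
qed

lemma closure_property_embeddings: "closure_property small C I \<Longrightarrow> I \<subseteq> embeddings small C"
  by (simp add: closure_property_def)

lemma closure_property_base_change:
  assumes "closure_property small C I" "(Q, P) \<in> I"
    and "presheaf small C P'" "presheaf_morphism C P' P \<alpha>"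
  shows "(base_change \<alpha> P' Q, P') \<in> I"
proof -
  have "\<forall>(Q, P)\<in>I. \<forall>P' \<alpha>. presheaf small C P' \<and> presheaf_morphism C P' P \<alpha>
      \<longrightarrow> (base_change \<alpha> P' Q, P') \<in> I"
    using assms(1) by (simp add: closure_property_def)
  with assms(2-4) show ?thesis
    by blast
qed

lemma closure_of_base_change:
  assumes "closure_property small C I" "presheaf small C P" "subpresheaf C Q P"
    and "presheaf small C P'" "presheaf_morphism C P' P \<alpha>"
  shows "closure_of I P' (base_change \<alpha> P' Q) = base_change \<alpha> P' (closure_of I P Q)"
proof -
  have "\<forall>(Q, P)\<in>embeddings small C. \<forall>P' \<alpha>. presheaf small C P' \<and> presheaf_morphism C P' P \<alpha>
      \<longrightarrow> closure_of I P' (base_change \<alpha> P' Q) = base_change \<alpha> P' (closure_of I P Q)"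
    using assms(1) by (simp add: closure_property_def)
  moreover have "(Q, P) \<in> embeddings small C"
    using assms(2,3) by (simp add: embeddings_def)
  ultimately show ?thesis
    using assms(4,5) by blast
qed

lemma sieve_is_closure:
  assumes "closure_property small C I" "(D, X) \<in> sieves C"
  shows "is_closure I (yoneda C X) D (closure_of I (yoneda C X) D)"
  using closure_of_is_closure[OF assms(1)] presheaf_y sieve_Ob[OF assms(2)]
    sieve_subpresheaf[OF assms(2)]
  by (simp add: embeddings_def)

text \<open>
  If \<open>D\<close> is in \<open>G_R I\<close>, it is dual to its own closure, which therefore contains the identity.
  Conversely, if the closure of \<open>D\<close> is maximal, so is that of \<open>x\<^sup>*D\<close>. When \<open>x\<^sup>*D\<close> sends \<open>p\<close> into a member
  \<open>Q\<close> of \<open>I\<close>, it is contained in the sieve of \<open>p\<close>, which is a base change of \<open>Q\<close> and hence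
  closed; so the latter is maximal and \<open>p\<close> lies in \<open>Q\<close>.
\<close>

lemma G_R_closure_property:
  assumes I: "closure_property small C I"
  shows "G_R small C I = {(D, X) \<in> sieves C. closure_of I (yoneda C X) D = Sec (yoneda C X)}"
proof (intro equalityI subrelI)
  fix D X
  assume D: "(D, X) \<in> G_R small C I"
  then have sieve: "(D, X) \<in> sieves C"
    by (simp add: G_R_def)
  then have X: "X \<in> Ob C"
    by (rule sieve_Ob)
  let ?cl = "closure_of I (yoneda C X) D"
  have cl: "(?cl, yoneda C X) \<in> I" "D \<le> ?cl"
    using sieve_is_closure[OF I sieve] by (auto simp: is_closure_def le_fun_def)
  then have "(?cl, X) \<in> sieves C"
    using closure_property_embeddings[OF I] X by (auto simp: embeddings_def sieves_def)
  moreover have "Idt C X \<in> ?cl X"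
  proof (rule dualityD[where Q = ?cl])
    show "((D, X), ?cl, yoneda C X) \<in> duality small C"
      using cl D G_R_D by blast
    show "Idt C X \<in> Sec (yoneda C X) X"
      using X Idt_in by (simp add: in_Sec_yoneda)
    have "D \<le> sieve_pullback C X X (Idt C X) ?cl"
      using cl(2) sieve_pullback_Idt[OF \<open>(?cl, X) \<in> sieves C\<close>] by simp
    then show "D \<le> section_sieve (yoneda C X) ?cl X (Idt C X)"
      using sieve_pullback_eq X Idt_in by simp
  qed
  ultimately show "(D, X) \<in> {(D, X) \<in> sieves C. closure_of I (yoneda C X) D = Sec (yoneda C X)}"
    using sieve sieve_eq_maximal by blast
next
  fix D X
  assume "(D, X) \<in> {(D, X) \<in> sieves C. closure_of I (yoneda C X) D = Sec (yoneda C X)}"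
  then have sieve: "(D, X) \<in> sieves C" and max: "closure_of I (yoneda C X) D = Sec (yoneda C X)"
    by auto
  have X: "X \<in> Ob C"
    using sieve by (rule sieve_Ob)
  show "(D, X) \<in> G_R small C I"
  proof (rule G_R_I[OF closure_property_embeddings[OF I] sieve])
    fix Q P X' x p
    assume Q: "(Q, P) \<in> I" and P: "presheaf small C P" and X': "X' \<in> Ob C" "x \<in> Hom C X' X"
      and p: "p \<in> Sec P X'" and le: "sieve_pullback C X' X x D \<le> section_sieve P Q X' p"
    have x: "presheaf_morphism C (yoneda C X') (yoneda C X) (yoneda_map C X' X x)"
      using presheaf_morphism_yoneda_map[OF locally_small X X'] .
    have "closure_of I (yoneda C X') (sieve_pullback C X' X x D)
        = base_change (yoneda_map C X' X x) (yoneda C X') (Sec (yoneda C X))"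
      unfolding sieve_pullback_def max[symmetric]
      using closure_of_base_change[OF I presheaf_y[OF X] sieve_subpresheaf[OF sieve]
          presheaf_y[OF X'(1)] x] .
    also have "\<dots> = Sec (yoneda C X')"
      by (rule base_change_Sec[OF presheaf_y[OF X'(1)] x])
    finally have "is_closure I (yoneda C X') (sieve_pullback C X' X x D) (Sec (yoneda C X'))"
      using sieve_is_closure[OF I sieve_pullback_in_sieves[OF sieve X']] by simp
    moreover have "(section_sieve P Q X' p, yoneda C X') \<in> I"
      unfolding section_sieve_def
      by (rule closure_property_base_change[OF I Q presheaf_y[OF X'(1)] section_morphism[OF P p]])
    ultimately have "Sec (yoneda C X') X' \<subseteq> section_sieve P Q X' p X'"
      using le by (simp add: is_closure_def le_fun_def)
    then have "Idt C X' \<in> section_sieve P Q X' p X'"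
      using X' Idt_in by (auto simp: in_Sec_yoneda)
    then show "p \<in> Q X'"
      using Idt_in_section_sieve P p by blast
  qed
qed

lemma F_R_G_R_closure_property:
  assumes I: "closure_property small C I"
  shows "F_R small C (G_R small C I) = I"
proof (intro equalityI subrelI)
  fix Q P
  assume "(Q, P) \<in> I"
  then show "(Q, P) \<in> F_R small C (G_R small C I)"
    using closure_property_embeddings[OF I] by (auto simp: G_R_def F_R_def)
next
  fix Q P
  assume QP: "(Q, P) \<in> F_R small C (G_R small C I)"
  then have P: "presheaf small C P" and Q: "subpresheaf C Q P"
    using F_R_embedding by auto
  then have QP': "(Q, P) \<in> embeddings small C"
    by (simp add: embeddings_def)
  let ?cl = "closure_of I P Q"
  have cl: "is_closure I P Q ?cl"
    using closure_of_is_closure[OF I QP'] .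
  then have sub: "subpresheaf C ?cl P"
    using closure_property_embeddings[OF I] by (auto simp: is_closure_def embeddings_def)
  have "p \<in> Q X" if p: "p \<in> ?cl X" for p X
  proof -
    have pP: "p \<in> Sec P X"
      using sub p by (auto simp: subpresheaf_def)
    then have X: "X \<in> Ob C"
      using Sec_Ob P by blast
    have "closure_of I (yoneda C X) (section_sieve P Q X p) = section_sieve P ?cl X p"
      unfolding section_sieve_def
      using closure_of_base_change[OF I P Q presheaf_y[OF X] section_morphism[OF P pP]] .
    also have "\<dots> = Sec (yoneda C X)"
      using sieve_eq_maximal section_sieve_in_sieves[OF P sub pP] Idt_in_section_sieve[OF P pP] p
      by blast
    finally have "(section_sieve P Q X p, X) \<in> G_R small C I"
      using G_R_closure_property[OF I] section_sieve_in_sieves[OF P Q pP] by simp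
    then show ?thesis
      using dualityD[OF F_R_D[OF QP] pP] by blast
  qed
  then have "?cl = Q"
    using cl by (intro ext subset_antisym) (auto simp: is_closure_def)
  with cl show "(Q, P) \<in> I"
    by (simp add: is_closure_def)
qed

section \<open>The duality theorem\<close>

lemma F_R_antimono: "J \<subseteq> J' \<Longrightarrow> F_R small C J' \<subseteq> F_R small C J"
  by (auto simp: F_R_def)

lemma G_R_antimono: "I \<subseteq> I' \<Longrightarrow> G_R small C I' \<subseteq> G_R small C I"
  by (auto simp: G_R_def)

lemma F_R_G_R_F_R: "J \<subseteq> sieves C \<Longrightarrow> F_R small C (G_R small C (F_R small C J)) = F_R small C J"
  by (auto simp: F_R_def G_R_def)

lemma G_R_F_R_G_R: "I \<subseteq> embeddings small C \<Longrightarrow> G_R small C (F_R small C (G_R small C I)) = G_R small C I"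
  by (auto simp: F_R_def G_R_def)

lemma generated_topology_G_R_F_R:
  assumes J: "J \<subseteq> sieves C"
  shows "is_generated_topology C J (G_R small C (F_R small C J))"
  unfolding is_generated_topology_def
proof (intro conjI allI impI)
  show "topology C (G_R small C (F_R small C J))"
    by (rule topology_G_R) (auto simp: F_R_def)
  show "J \<subseteq> G_R small C (F_R small C J)"
    using J by (auto simp: F_R_def G_R_def)
  show "G_R small C (F_R small C J) \<subseteq> K" if "topology C K \<and> J \<subseteq> K" for K
    using G_R_antimono[OF F_R_antimono] G_R_F_R_topology that by blast
qed

lemma generated_closure_property_F_R_G_R:
  assumes I: "I \<subseteq> embeddings small C"
  shows "is_generated_closure_property small C I (F_R small C (G_R small C I))"
  unfolding is_generated_closure_property_def
proof (intro conjI allI impI)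
  show "closure_property small C (F_R small C (G_R small C I))"
    using closure_property_F_R topology_G_R I by blast
  show "I \<subseteq> F_R small C (G_R small C I)"
    using I by (auto simp: F_R_def G_R_def)
  show "F_R small C (G_R small C I) \<subseteq> I'" if "closure_property small C I' \<and> I \<subseteq> I'" for I'
    using F_R_antimono[OF G_R_antimono] F_R_G_R_closure_property that by blast
qed

end

theorem mainTheorem8:
  fixes small :: "'u set \<Rightarrow> bool" and C :: "('o, 'u) cat"
  assumes "set_universe small" and "essentially_small small C"
  shows
    "(\<forall>J. J \<subseteq> sieves C \<longrightarrow>
        (let J' = G_R small C (F_R small C J) in
           is_generated_topology C J J' \<and>
           F_R small C J = F_R small C J' \<and>
           F_R small C J = closed_embeddings small C J' \<and>
           (\<forall>(Q, P)\<in>embeddings small C. \<exists>!Q'. is_closure (closed_embeddings small C J') P Q Q')))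
     \<and>
     (\<forall>I. I \<subseteq> embeddings small C \<longrightarrow>
        (let I' = F_R small C (G_R small C I) in
           is_generated_closure_property small C I I' \<and>
           G_R small C I = G_R small C I' \<and>
           topology C (G_R small C I) \<and>
           G_R small C I =
             {(D, X) \<in> sieves C. closure_of I' (yoneda C X) D = Sec (yoneda C X)}))"
proof -
  interpret locally_small small C
    using assms(2) by unfold_locales (simp add: essentially_small_def)
  have sieves_to_subpresheaves:
    "is_generated_topology C J J' \<and> F_R small C J = F_R small C J' \<and>
      F_R small C J = closed_embeddings small C J' \<and>
      (\<forall>(Q, P)\<in>embeddings small C. \<exists>!Q'. is_closure (closed_embeddings small C J') P Q Q')"
    if J: "J \<subseteq> sieves C" and J': "J' = G_R small C (F_R small C J)" for J J'
  proof -
    have gen: "is_generated_topology C J J'"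
      unfolding J' by (rule generated_topology_G_R_F_R[OF J])
    then have K: "topology C J'"
      by (simp add: is_generated_topology_def)
    have "\<exists>!Q'. is_closure (closed_embeddings small C J') P Q Q'"
      if "(Q, P) \<in> embeddings small C" for Q P
      unfolding closed_embeddings_eq[OF K]
      using that is_closure_local_closure[OF K] is_closure_unique by (auto simp: embeddings_def)
    moreover have "F_R small C J = F_R small C J'"
      unfolding J' by (rule F_R_G_R_F_R[OF J, symmetric])
    ultimately show ?thesis
      using gen closed_embeddings_eq[OF K] by blast
  qed
  have subpresheaves_to_sieves:
    "is_generated_closure_property small C I I' \<and> G_R small C I = G_R small C I' \<and>
      topology C (G_R small C I) \<and>
      G_R small C I = {(D, X) \<in> sieves C. closure_of I' (yoneda C X) D = Sec (yoneda C X)}"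
    if I: "I \<subseteq> embeddings small C" and I': "I' = F_R small C (G_R small C I)" for I I'
  proof -
    have gen: "is_generated_closure_property small C I I'"
      unfolding I' by (rule generated_closure_property_F_R_G_R[OF I])
    then have "closure_property small C I'"
      by (simp add: is_generated_closure_property_def)
    moreover have "G_R small C I = G_R small C I'"
      unfolding I' by (rule G_R_F_R_G_R[OF I, symmetric])
    ultimately show ?thesis
      using gen topology_G_R[OF I] G_R_closure_property by simp
  qed
  show ?thesis
    unfolding Let_def
    by (intro conjI[OF allI allI] impI sieves_to_subpresheaves[OF _ refl]
        subpresheaves_to_sieves[OF _ refl])
qed

end
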